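(* In the setting described in the context, the trajectory $u_\delta(t)$ remains in the ball $B(u_0,R):=\{u:\|u-u_0\|<R\}$ for all $t\le t_\delta$, where $R$ does not depend on $\delta$ as $\delta\to0$. Indeed, with $C:=\frac{C_1+1}{2}$, $$\|u_\delta(t)-u_0\|\le\|u_\delta(t)-V_\delta(t)\|+\|V_\delta(t)\|+\|u_0\|\le\frac{a(0)}{\lambda}+\frac{C\|y\|}{C-1}+\|u_0\|:=R,\qquad\forall t\le t_\delta.$$ Moreover, since one can choose $a(t)$ and $\lambda$ so that $\frac{a(0)}{\lambda}$ is uniformly bounded as $\delta\to0$, regardless of the growth of $M_1$ (that is, regardless of the rate of growth of $M_1=M_1(u_0,r)$ as $r\to\infty$), $R$ can be chosen independent of $\delta$ and $M_1$.
   Context: Setting. $H$ is a real Hilbert space; $F:H\to H$ is monotone, i.e. $\langle F(u)-F(v),u-v\rangle\ge0$ for all $u,v\in H$, and twice Fréchet differentiable, with $\sup_{\|u-u_0\|\le r}\|F^{(j)}(u)\|\le M_j(u_0,r)$ for $0\le j\le2$ and arbitrary $r>0$ ($F^{(j)}$ is the $j$-th Fréchet derivative, $F^{(0)}=F$); $M_j$ denotes the constant in this bound. The equation $F(u)=f$ is solvable and $y$ is its unique solution of minimal norm. The noisy data $f_\delta$ satisfy $\|f_\delta-f\|\le\delta$, $\delta\in(0,1)$. For $a>0$, $V_{\delta,a}$ is the unique solution of $F(V_{\delta,a})+aV_{\delta,a}-f_\delta=0$, and $V_\delta(t):=V_{\delta,a(t)}$. $a(t)=\frac{d}{(c+t)^b}$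 with constants $b\in(0,1]$, $c,d>0$, $c>6b$, and $d$ so large that, with positive constants $c_0,c_1,\lambda$, $$\frac{c_0}{a(t)}\le \frac{\lambda}{2a(t)}\left[1-\frac{|\dot a(t)|}{a(t)}\right],\qquad c_1\frac{|\dot a(t)|}{a(t)}\le \frac{a(t)}{2\lambda}\left[1-\frac{|\dot a(t)|}{a(t)}\right],\qquad \|F(0)-f_\delta\|\le\frac{a^2(0)}{\lambda}.$$ These conditions come from an auxiliary lemma of the paper (for $y\ne0$), which provides $\lambda$ with also $M_1/\|y\|\le\lambda$; the paper's argument uses it with $c_0=\frac{M_2}{2}$ and $c_1=\|y\|\left(1+\frac1{C-1}\right)$. $u_0\in H$ satisfies $\|u_0-V_\delta(0)\|\le\frac{\|F(0)-f_\delta\|}{a(0)}$ and $\|F(u_0)+a(0)u_0-f_\delta\|\le\frac14a(0)\|V_\delta(0)\|$; $C_1>1$ and $\zeta\in(0,1]$ are constants with $\|F(u_0)-f_\delta\|>C_1\delta^\zeta$. $u_\delta(t)$ is the solution of $$\dot u_\delta=-\left(F'(u_\delta)+a(t)I\right)^{-1}\left[F(u_\delta)+a(t)u_\delta-f_\delta\right],\qquad u_\delta(0)=u_0$$ ($I$ the identity, the dot is $d/dt$), and $t_\delta$ is the stopping time determined by $\|F(u_\delta(t_\delta))-f_\delta\|=C_1\delta^\zeta$ and $\|F(u_\delta(t))-f_\delta\|>C_1\delta^\zeta$ for all $t\in[0,t_\delta)$. *)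

theory Defs
  imports "HOL-Analysis.Analysis"
begin

text \<open>A real Hilbert space is a type of sort \<open>{real_inner, banach}\<close>. Frechet derivatives are carried
  as functions into the bounded linear operators, so \<open>norm (F' u)\<close> and \<open>norm (F'' u)\<close> are operator
  norms; for \<open>F''\<close> this is the usual norm of a bounded bilinear map.\<close>

definition monotone_operator :: "('a::real_inner \<Rightarrow> 'a) \<Rightarrow> bool" where
  "monotone_operator F \<longleftrightarrow> (\<forall>u v. inner (F u - F v) (u - v) \<ge> 0)"

definition twice_frechet ::
  "('a::real_normed_vector \<Rightarrow> 'a) \<Rightarrow> ('a \<Rightarrow> 'a \<Rightarrow>\<^sub>L 'a) \<Rightarrow> ('a \<Rightarrow> 'a \<Rightarrow>\<^sub>L ('a \<Rightarrow>\<^sub>L 'a)) \<Rightarrow> bool" where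
  "twice_frechet F F' F'' \<longleftrightarrow>
     (\<forall>u. (F has_derivative blinfun_apply (F' u)) (at u)) \<and>
     (\<forall>u. (F' has_derivative blinfun_apply (F'' u)) (at u))"

definition frechet_bounds ::
  "('a::real_normed_vector \<Rightarrow> 'a) \<Rightarrow> ('a \<Rightarrow> 'a \<Rightarrow>\<^sub>L 'a) \<Rightarrow> ('a \<Rightarrow> 'a \<Rightarrow>\<^sub>L ('a \<Rightarrow>\<^sub>L 'a)) \<Rightarrow>
   'a \<Rightarrow> real \<Rightarrow> (nat \<Rightarrow> real) \<Rightarrow> bool" where
  "frechet_bounds F F' F'' u0 r M \<longleftrightarrow>
     (\<forall>u\<in>cball u0 r. norm (F u) \<le> M 0 \<and> norm (F' u) \<le> M 1 \<and> norm (F'' u) \<le> M 2)"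

definition minimal_norm_solution :: "('a::real_normed_vector \<Rightarrow> 'a) \<Rightarrow> 'a \<Rightarrow> 'a \<Rightarrow> bool" where
  "minimal_norm_solution F f y \<longleftrightarrow> F y = f \<and> (\<forall>z. F z = f \<and> z \<noteq> y \<longrightarrow> norm y < norm z)"

definition monotone_problem ::
  "('a::{real_inner,banach} \<Rightarrow> 'a) \<Rightarrow> ('a \<Rightarrow> 'a \<Rightarrow>\<^sub>L 'a) \<Rightarrow> ('a \<Rightarrow> 'a \<Rightarrow>\<^sub>L ('a \<Rightarrow>\<^sub>L 'a)) \<Rightarrow> 'a \<Rightarrow> 'a \<Rightarrow> bool" where
  "monotone_problem F F' F'' f y \<longleftrightarrow>
     monotone_operator F \<and> twice_frechet F F' F'' \<and>
     (\<forall>u0 r. r > 0 \<longrightarrow> (\<exists>M. frechet_bounds F F' F'' u0 r M)) \<and>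
     minimal_norm_solution F f y"

definition noisy_data :: "'a::real_normed_vector \<Rightarrow> real \<Rightarrow> 'a \<Rightarrow> bool" where
  "noisy_data f \<delta> f\<^sub>\<delta> \<longleftrightarrow> 0 < \<delta> \<and> \<delta> < 1 \<and> norm (f\<^sub>\<delta> - f) \<le> \<delta>"

definition reg_fun :: "real \<Rightarrow> real \<Rightarrow> real \<Rightarrow> real \<Rightarrow> real" where
  "reg_fun b c d t = d / (c + t) powr b"

definition reg_conditions :: "(real \<Rightarrow> real) \<Rightarrow> real \<Rightarrow> real \<Rightarrow> real \<Rightarrow> real \<Rightarrow> bool" where
  "reg_conditions a c0 c1 lam e \<longleftrightarrow>
     0 < c0 \<and> 0 < c1 \<and> 0 < lam \<and>
     (\<forall>t\<ge>0. c0 / a t \<le> lam / (2 * a t) * (1 - \<bar>deriv a t\<bar> / a t)) \<and>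
     (\<forall>t\<ge>0. c1 * (\<bar>deriv a t\<bar> / a t) \<le> a t / (2 * lam) * (1 - \<bar>deriv a t\<bar> / a t)) \<and>
     e \<le> (a 0)\<^sup>2 / lam"

definition admissible_parameters ::
  "('a::real_normed_vector \<Rightarrow> 'a) \<Rightarrow> 'a \<Rightarrow> 'a \<Rightarrow> real \<Rightarrow> (nat \<Rightarrow> real) \<Rightarrow>
   real \<Rightarrow> real \<Rightarrow> real \<Rightarrow> real \<Rightarrow> bool" where
  "admissible_parameters F f\<^sub>\<delta> y C M b c d lam \<longleftrightarrow>
     0 < d \<and> M 1 / norm y \<le> lam \<and>
     reg_conditions (reg_fun b c d) (M 2 / 2) (norm y * (1 + 1 / (C - 1))) lam (norm (F 0 - f\<^sub>\<delta>))"

text \<open>\<open>V s\<close> is the unique solution of the regularized equation with parameter \<open>s\<close>; the function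
  \<open>V\<^sub>\<delta>\<close> of time is \<open>V \<circ> a\<close>.\<close>

definition regularized_solutions :: "('a::real_normed_vector \<Rightarrow> 'a) \<Rightarrow> 'a \<Rightarrow> (real \<Rightarrow> 'a) \<Rightarrow> bool" where
  "regularized_solutions F f\<^sub>\<delta> V \<longleftrightarrow> (\<forall>s>0. \<forall>v. F v + s *\<^sub>R v - f\<^sub>\<delta> = 0 \<longleftrightarrow> v = V s)"

definition admissible_start ::
  "('a::real_normed_vector \<Rightarrow> 'a) \<Rightarrow> 'a \<Rightarrow> (real \<Rightarrow> real) \<Rightarrow> (real \<Rightarrow> 'a) \<Rightarrow> real \<Rightarrow> 'a \<Rightarrow> bool" where
  "admissible_start F f\<^sub>\<delta> a V level u0 \<longleftrightarrow>
     norm (u0 - V (a 0)) \<le> norm (F 0 - f\<^sub>\<delta>) / a 0 \<and>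
     norm (F u0 + a 0 *\<^sub>R u0 - f\<^sub>\<delta>) \<le> 1 / 4 * a 0 * norm (V (a 0)) \<and>
     norm (F u0 - f\<^sub>\<delta>) > level"

text \<open>For monotone \<open>F\<close> and \<open>a t > 0\<close> the operator \<open>F' (u t) + a t I\<close> is a bijection, so \<open>inv\<close> is
  its inverse.\<close>

definition newton_trajectory ::
  "('a::real_normed_vector \<Rightarrow> 'a) \<Rightarrow> ('a \<Rightarrow> 'a \<Rightarrow>\<^sub>L 'a) \<Rightarrow> 'a \<Rightarrow> (real \<Rightarrow> real) \<Rightarrow> 'a \<Rightarrow> real \<Rightarrow>
   (real \<Rightarrow> 'a) \<Rightarrow> bool" where
  "newton_trajectory F F' f\<^sub>\<delta> a u0 T u \<longleftrightarrow>
     u 0 = u0 \<and>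
     (\<forall>t\<in>{0..T}.
        (u has_vector_derivative
           - inv (\<lambda>h. F' (u t) h + a t *\<^sub>R h) (F (u t) + a t *\<^sub>R u t - f\<^sub>\<delta>)) (at t within {0..T}))"

definition stopping_time ::
  "('a::real_normed_vector \<Rightarrow> 'a) \<Rightarrow> 'a \<Rightarrow> (real \<Rightarrow> 'a) \<Rightarrow> real \<Rightarrow> real \<Rightarrow> bool" where
  "stopping_time F f\<^sub>\<delta> u level T \<longleftrightarrow>
     0 \<le> T \<and> norm (F (u T) - f\<^sub>\<delta>) = level \<and> (\<forall>t\<in>{0..<T}. norm (F (u t) - f\<^sub>\<delta>) > level)"

definition traj_radius :: "real \<Rightarrow> real \<Rightarrow> real \<Rightarrow> 'a::real_normed_vector \<Rightarrow> 'a \<Rightarrow> real" where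
  "traj_radius a0 lam C y u0 = a0 / lam + C * norm y / (C - 1) + norm u0"

end

theory Submission
  imports Defs
begin

text \<open>
  Put \<open>g(t) = \<parallel>u(t) - V(a(t))\<parallel>\<close>. Two estimates are propagated together along \<open>[0, t\<^sub>\<delta>]\<close>:
  \<open>g \<le> a/\<lambda>\<close> and \<open>\<delta> (C - 1) \<le> a \<parallel>y\<parallel>\<close>. The second bounds \<open>\<parallel>V(a(t))\<parallel>\<close> by \<open>C \<parallel>y\<parallel> / (C - 1)\<close>, so both
  \<open>u\<close> and \<open>V \<circ> a\<close> stay in the ball where the derivative bounds hold. Before \<open>t\<^sub>\<delta>\<close> the residual exceeds
  \<open>C1 \<delta>\<close>, and \<open>\<parallel>F(u) - f\<^sub>\<delta>\<parallel> \<le> M\<^sub>1 g + a \<parallel>V\<parallel> \<le> 2 a \<parallel>y\<parallel> + \<delta>\<close> makes the second estimate strict. Taylor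
  expansion gives \<open>g' \<le> - g + c\<^sub>0 g\<^sup>2 / a + \<bar>a'\<bar> \<parallel>V\<parallel> / a\<close> as an upper right Dini derivative, and when
  \<open>g = a/\<lambda>\<close> the conditions on \<open>a\<close> make this less than \<open>(a/\<lambda>)'\<close>, strictly because \<open>\<parallel>V\<parallel> < c\<^sub>1\<close>; hence
  \<open>g\<close> cannot cross \<open>a/\<lambda>\<close>. For the uniform radius, \<open>d\<close> is taken proportional to \<open>\<lambda>\<close>: then \<open>a(0)/\<lambda>\<close> is a
  constant and every condition becomes a lower bound on \<open>\<lambda>\<close>.
\<close>

section \<open>Induction along a real interval\<close>

text \<open>A one-sided continuation principle: openness is asked only to the right. At the infimum
  of the failure points the property holds by \<open>start\<close> or \<open>closed\<close>, and
  \<open>right\<close> then keeps all failure points a fixed distance beyond it, a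
  contradiction.\<close>

lemma real_interval_induct:
  fixes T :: real
  assumes start: "P 0"
    and closed: "\<And>t. 0 < t \<Longrightarrow> t \<le> T \<Longrightarrow> (\<And>s. 0 \<le> s \<Longrightarrow> s < t \<Longrightarrow> P s) \<Longrightarrow> P t"
    and right: "\<And>t. 0 \<le> t \<Longrightarrow> t < T \<Longrightarrow> P t \<Longrightarrow> \<exists>e>0. \<forall>s. t < s \<and> s < t + e \<and> s \<le> T \<longrightarrow> P s"
    and t: "t \<in> {0..T}"
  shows "P t"
proof (rule ccontr)
  assume nP: "\<not> P t"
  define N where "N = {s \<in> {0..T}. \<not> P s}"
  have tN: "t \<in> N" using t nP by (simp add: N_def)
  have bdd: "bdd_below N" by (rule bdd_belowI[of _ 0]) (simp add: N_def)
  define m where "m = Inf N"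
  have m: "0 \<le> m" "m \<le> t"
    unfolding m_def using tN cInf_lower[OF tN bdd] by (auto intro: cInf_greatest simp: N_def)
  have below: "P s" if "0 \<le> s" "s < m" for s
  proof (rule ccontr)
    assume "\<not> P s"
    then have "s \<in> N" using that m t by (simp add: N_def)
    then show False using cInf_lower[OF _ bdd, of s] that by (simp add: m_def)
  qed
  have Pm: "P m"
  proof (cases "m = 0")
    case False
    show ?thesis
      by (rule closed) (use False m t below in auto)
  qed (use start in simp)
  then have "m < T" using m t nP by (cases "m = t") auto
  from right[OF m(1) this Pm] obtain e where e: "e > 0" "\<And>s. m < s \<Longrightarrow> s < m + e \<Longrightarrow> s \<le> T \<Longrightarrow> P s"
    by blast
  have "Inf N < m + e" using e by (simp add: m_def)
  then obtain s where s: "s \<in> N" "s < m + e"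
    using cInf_lessD[of N "m + e"] tN by blast
  have "m \<le> s" using cInf_lower[OF s(1) bdd] by (simp add: m_def)
  moreover have "m \<noteq> s" using s Pm by (auto simp: N_def)
  ultimately have "P s" using e(2)[of s] s by (simp add: N_def)
  then show False using s by (simp add: N_def)
qed

section \<open>Monotonicity and the linearized operator\<close>

text \<open>The number in question is the derivative at 0 of s -> <F(x + s h), h>. Were it negative,
  this function would drop immediately to the right of 0, against monotonicity for the pair x + s h,
  x.\<close>

lemma monotone_derivative_nonneg:
  fixes F :: "'a::real_inner \<Rightarrow> 'a"
  assumes mono: "monotone_operator F" and D: "(F has_derivative D) (at x)"
  shows "0 \<le> inner (D h) h"
proof -
  interpret D: bounded_linear D using D by (rule has_derivative_bounded_linear)
  have l: "((\<lambda>s. x + s *\<^sub>R h) has_derivative (\<lambda>s. s *\<^sub>R h)) (at (0::real))"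
    by (auto intro!: derivative_eq_intros)
  have "((\<lambda>s. F (x + s *\<^sub>R h)) has_derivative (\<lambda>s. D (s *\<^sub>R h))) (at (0::real))"
    using has_derivative_compose[OF l, of F D] D by simp
  then have "((\<lambda>s. inner (F (x + s *\<^sub>R h)) h) has_derivative (\<lambda>s. inner (D (s *\<^sub>R h)) h)) (at (0::real))"
    by (rule has_derivative_inner_left)
  then have d: "((\<lambda>s. inner (F (x + s *\<^sub>R h)) h) has_real_derivative inner (D h) h) (at 0)"
    by (simp add: has_field_derivative_def D.scaleR mult.commute[of _ "inner (D h) h"])
  show ?thesis
  proof (rule ccontr)
    assume "\<not> ?thesis"
    then obtain e where e: "e > 0"
      "\<And>s. 0 < s \<Longrightarrow> s < e \<Longrightarrow> inner (F (x + (0 + s) *\<^sub>R h)) h < inner (F (x + 0 *\<^sub>R h)) h"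
      using DERIV_neg_dec_right[OF d] by force
    then have "inner (F (x + (e/2) *\<^sub>R h) - F x) h < 0"
      using e(2)[of "e/2"] by (simp add: inner_diff_left)
    then have "inner (F (x + (e/2) *\<^sub>R h) - F x) ((e/2) *\<^sub>R h) < 0"
      using e(1) by (simp add: mult_pos_neg)
    moreover have "inner (F (x + (e/2) *\<^sub>R h) - F x) (x + (e/2) *\<^sub>R h - x) \<ge> 0"
      using mono unfolding monotone_operator_def by blast
    ultimately show False by simp
  qed
qed

text \<open>Pair \<open>D h + a *\<^sub>R h\<close> with \<open>h\<close> and apply Cauchy-Schwarz.
  This is the bound 1/a for the resolvent, phrased without an inverse.\<close>

lemma coercive_norm_bound:
  fixes D :: "'a::real_inner \<Rightarrow> 'a"
  assumes "0 \<le> inner (D h) h" "0 < a"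
  shows "norm h \<le> norm (D h + a *\<^sub>R h) / a"
proof (cases "h = 0")
  case False
  have "a * (norm h * norm h) \<le> inner (D h + a *\<^sub>R h) h"
    using assms by (simp add: inner_add_left flip: power2_norm_eq_inner power2_eq_square)
  also have "\<dots> \<le> norm (D h + a *\<^sub>R h) * norm h"
    by (rule norm_cauchy_schwarz)
  finally have "a * norm h \<le> norm (D h + a *\<^sub>R h)"
    using False by (simp add: mult.assoc[symmetric])
  then show ?thesis using assms by (simp add: field_simps)
qed (use assms in simp)

text \<open>The trajectory is defined through \<open>inv\<close>, which is a right inverse only of a
  surjective map; this supplies the surjectivity.\<close>

lemma coercive_surj:
  fixes D :: "'a::{real_inner,banach} \<Rightarrow> 'a"
  assumes D: "bounded_linear D" and nonneg: "\<And>h. 0 \<le> inner (D h) h" and a: "0 < a"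
  shows "surj (\<lambda>h. D h + a *\<^sub>R h)"
proof -
  define A where "A = (\<lambda>h. D h + a *\<^sub>R h)"
  interpret A: bounded_linear A
    unfolding A_def by (intro bounded_linear_add D bounded_linear_scaleR_right)
  obtain K where K: "K > 0" "\<And>h. norm (A h) \<le> norm h * K" using A.pos_bounded by blast
  have co: "a * (norm h)\<^sup>2 \<le> inner (A h) h" for h
    using nonneg[of h] by (simp add: A_def inner_add_left power2_norm_eq_inner)
  \<comment> \<open>Adding \<open>a\<close> to the operator bound forces \<open>a < L\<close>, which
    keeps \<open>q\<close> below nonnegative, so that \<open>sqrt q\<close> is a genuine contraction
    constant.\<close>
  define L where "L = K + a"
  have L: "L > 0" "\<And>h. norm (A h) \<le> L * norm h" "a < L"
    using K a by (auto simp: L_def distrib_right intro: order.trans[OF K(2)])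
  \<comment> \<open>Lax-Milgram: \<open>h \<mapsto> h - r (A h - b)\<close> is a contraction, and \<open>r\<close> minimises its constant.\<close>
  define r where "r = a / L\<^sup>2"
  have r: "r > 0" using a L by (simp add: r_def)
  define q where "q = 1 - a\<^sup>2 / L\<^sup>2"
  have q: "0 \<le> q" "q < 1"
    using a L power_mono[of a L 2] by (auto simp: q_def)
  have contr: "norm (h - r *\<^sub>R A h) \<le> sqrt q * norm h" for h
  proof -
    have "(norm (h - r *\<^sub>R A h))\<^sup>2 = (norm h)\<^sup>2 - 2 * r * inner (A h) h + r\<^sup>2 * (norm (A h))\<^sup>2"
      unfolding power2_norm_eq_inner
      by (simp add: inner_diff_left inner_diff_right inner_commute power2_eq_square algebra_simps)
    also have "\<dots> \<le> (norm h)\<^sup>2 - 2 * r * (a * (norm h)\<^sup>2) + r\<^sup>2 * (L * norm h)\<^sup>2"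
      using co[of h] r L(2)[of h] by (intro add_mono diff_mono mult_left_mono power_mono) auto
    also have "\<dots> = (1 - 2 * r * a + r\<^sup>2 * L\<^sup>2) * (norm h)\<^sup>2"
      by (simp add: algebra_simps)
    also have "1 - 2 * r * a + r\<^sup>2 * L\<^sup>2 = q"
      using L by (simp add: r_def q_def power2_eq_square field_simps)
    finally have "(norm (h - r *\<^sub>R A h))\<^sup>2 \<le> (sqrt q * norm h)\<^sup>2"
      using q by (simp add: power_mult_distrib)
    then show ?thesis by (rule power2_le_imp_le) (use q in simp)
  qed
  have "\<exists>h. A h = b" for b
  proof -
    have "\<exists>!h. h - r *\<^sub>R (A h - b) = h"
    proof (rule banach_fix_type[of "sqrt q"])
      show "\<forall>x z. dist (x - r *\<^sub>R (A x - b)) (z - r *\<^sub>R (A z - b)) \<le> sqrt q * dist x z"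
      proof (intro allI)
        fix x z
        have "x - r *\<^sub>R (A x - b) - (z - r *\<^sub>R (A z - b)) = (x - z) - r *\<^sub>R A (x - z)"
          by (simp add: A.diff algebra_simps)
        then show "dist (x - r *\<^sub>R (A x - b)) (z - r *\<^sub>R (A z - b)) \<le> sqrt q * dist x z"
          using contr[of "x - z"] unfolding dist_norm by metis
      qed
    qed (use q in \<open>auto simp: real_sqrt_lt_1_iff\<close>)
    then show ?thesis using r by auto
  qed
  then show ?thesis unfolding A_def surj_def by metis
qed

section \<open>Lipschitz and Taylor bounds on a ball\<close>

lemma frechet_lipschitz:
  fixes F :: "'a::real_normed_vector \<Rightarrow> 'a"
  assumes "twice_frechet F F' F''" "frechet_bounds F F' F'' u0 r M"
    and x: "x \<in> cball u0 r" and z: "z \<in> cball u0 r"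
  shows "norm (F x - F z) \<le> M 1 * norm (x - z)"
proof (rule differentiable_bound[of "cball u0 r" F "\<lambda>u. blinfun_apply (F' u)"])
  show "onorm (blinfun_apply (F' v)) \<le> M 1" if "v \<in> cball u0 r" for v
    using assms that by (auto simp: frechet_bounds_def norm_blinfun.rep_eq)
qed (use assms in \<open>auto simp: twice_frechet_def intro: has_derivative_at_withinI\<close>)

text \<open>The derivative is taken at \<open>x\<close>, the endpoint where the Newton step
  linearizes. Along the segment from \<open>z\<close> to \<open>x\<close>, the derivative of
  \<open>F\<close> minus its linear part is (F'(c s) - F'(x)) w with w = x - z, of norm at most M 2
  |w|^2 (1 - s); integration over [0, 1] yields the factor 1/2.\<close>

lemma frechet_taylor:
  fixes F :: "'a::real_normed_vector \<Rightarrow> 'a"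
  assumes tf: "twice_frechet F F' F''" and fb: "frechet_bounds F F' F'' u0 r M"
    and x: "x \<in> cball u0 r" and z: "z \<in> cball u0 r"
  shows "norm (F x - F z - F' x (x - z)) \<le> M 2 / 2 * (norm (x - z))\<^sup>2"
proof -
  let ?w = "x - z"
  let ?c = "\<lambda>s. z + s *\<^sub>R ?w"
  let ?p = "\<lambda>s. F (?c s) - s *\<^sub>R F' x ?w"
  \<comment> \<open>The antiderivative of M 2 |w|^2 (1 - s) that vanishes at s = 1, used as the
    majorant in the mean value inequality.\<close>
  let ?phi = "\<lambda>s::real. - (M 2 * (norm ?w)\<^sup>2 / 2) * (1 - s)\<^sup>2"
  have lip: "norm (F' p - F' q) \<le> M 2 * norm (p - q)" if "p \<in> cball u0 r" "q \<in> cball u0 r" for p q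
  proof (rule differentiable_bound[of "cball u0 r" F' "\<lambda>u. blinfun_apply (F'' u)"])
    show "onorm (blinfun_apply (F'' v)) \<le> M 2" if "v \<in> cball u0 r" for v
      using fb that by (auto simp: frechet_bounds_def norm_blinfun.rep_eq)
  qed (use tf that in \<open>auto simp: twice_frechet_def intro: has_derivative_at_withinI\<close>)
  have dp: "(?p has_vector_derivative (F' (?c s) ?w - F' x ?w)) (at s)" for s
  proof -
    have "(?c has_derivative (\<lambda>s. s *\<^sub>R ?w)) (at s)"
      by (auto intro!: derivative_eq_intros)
    then have "((\<lambda>s. F (?c s)) has_derivative (\<lambda>s'. F' (?c s) (s' *\<^sub>R ?w))) (at s)"
      using has_derivative_compose[of ?c _ s UNIV F "blinfun_apply (F' (?c s))"] tf
      by (simp add: twice_frechet_def)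
    then have "((\<lambda>s. F (?c s)) has_vector_derivative F' (?c s) ?w) (at s)"
      by (simp add: has_vector_derivative_def blinfun.scaleR_right)
    moreover have "((\<lambda>s. s *\<^sub>R F' x ?w) has_vector_derivative F' x ?w) (at s)"
      by (auto intro!: derivative_eq_intros)
    ultimately show ?thesis by (rule has_vector_derivative_diff)
  qed
  have "norm (?p 1 - ?p 0) \<le> ?phi 1 - ?phi 0"
  proof (rule differentiable_bound_general)
    show "continuous_on {0..1} ?p"
      using dp by (intro continuous_at_imp_continuous_on)
        (meson has_vector_derivative_continuous)
    show "(?phi has_vector_derivative (M 2 * (norm ?w)\<^sup>2 * (1 - s))) (at s)" for s
      unfolding has_real_derivative_iff_has_vector_derivative[symmetric]
      by (auto intro!: derivative_eq_intros simp: field_simps)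
    fix s :: real assume s: "0 < s" "s < 1"
    have "?c s \<in> cball u0 r"
    proof -
      have "?c s = (1 - s) *\<^sub>R z + s *\<^sub>R x" by (simp add: algebra_simps)
      then show ?thesis
        using s x z convexD_alt[OF convex_cball z x, of s] by simp
    qed
    then have "norm (F' (?c s) - F' x) \<le> M 2 * norm (?c s - x)" using lip x by blast
    also have "?c s - x = (s - 1) *\<^sub>R ?w" by (simp add: algebra_simps)
    also have "M 2 * norm \<dots> = M 2 * norm ?w * (1 - s)" using s by simp
    finally have "norm ((F' (?c s) - F' x) ?w) \<le> M 2 * norm ?w * (1 - s) * norm ?w"
      by (intro order.trans[OF norm_blinfun] mult_right_mono) auto
    then show "norm (F' (?c s) ?w - F' x ?w) \<le> M 2 * (norm ?w)\<^sup>2 * (1 - s)"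
      by (simp add: blinfun.diff_left power2_eq_square mult_ac)
  qed (auto intro!: continuous_intros dp)
  then show ?thesis by (simp add: algebra_simps)
qed

section \<open>Solutions of the regularized equation\<close>

lemma regularized_eq:
  assumes "regularized_solutions F f\<^sub>\<delta> V" "0 < s"
  shows "F (V s) + s *\<^sub>R V s - f\<^sub>\<delta> = 0"
  using assms by (simp add: regularized_solutions_def)

text \<open>Testing the difference of the equations for \<open>V s\<close> and \<open>y\<close> with
  \<open>V s - y\<close> removes \<open>F\<close> by monotonicity and leaves only the noise. The
  result is kept multiplied by \<open>s\<close>, the form in which it is combined with residual
  bounds.\<close>

lemma regularized_norm_bound:
  fixes F :: "'a::real_inner \<Rightarrow> 'a"
  assumes mono: "monotone_operator F" and V: "regularized_solutions F f\<^sub>\<delta> V" and s: "0 < s"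
    and \<delta>: "norm (f\<^sub>\<delta> - F y) \<le> \<delta>"
  shows "s * norm (V s) \<le> s * norm y + \<delta>"
proof -
  let ?w = "V s - y"
  let ?e = "\<delta> / s"
  have "0 \<le> \<delta>" using \<delta> norm_ge_zero order.trans by blast
  have "0 \<le> inner (F (V s) - F y) ?w"
    using mono by (simp add: monotone_operator_def)
  moreover have "F (V s) - F y = (f\<^sub>\<delta> - F y) - s *\<^sub>R V s"
    using regularized_eq[OF V s] by (simp add: algebra_simps eq_diff_eq)
  ultimately have "s * inner (V s) ?w \<le> inner (f\<^sub>\<delta> - F y) ?w"
    by (simp add: inner_diff_left)
  also have "\<dots> \<le> \<delta> * norm ?w"
    by (intro order.trans[OF norm_cauchy_schwarz] mult_right_mono \<delta>) simp
  finally have "s * inner (V s) ?w \<le> \<delta> * norm ?w" .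
  then have "inner (V s) ?w \<le> ?e * norm ?w"
    using s by (simp only: times_divide_eq_left pos_le_divide_eq mult.commute)
  \<comment> \<open>Polarization turns the inner product bound into a quadratic in |w| whose largest
    value is attained at |w| = e; completing the square gives |y|^2 + e^2, which is at most (|y| +
    e)^2.\<close>
  moreover have "(norm (V s))\<^sup>2 = (norm y)\<^sup>2 + 2 * inner (V s) ?w - (norm ?w)\<^sup>2"
    unfolding power2_norm_eq_inner
    by (simp add: inner_diff_left inner_diff_right inner_commute)
  ultimately have "(norm (V s))\<^sup>2 \<le> (norm y)\<^sup>2 + ?e\<^sup>2 - (norm ?w - ?e)\<^sup>2"
    unfolding power2_diff by (simp only: mult.commute[of "norm ?w"] mult.assoc)
  also have "\<dots> \<le> (norm y + ?e)\<^sup>2"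
  proof -
    have "0 \<le> 2 * norm y * ?e" using \<open>0 \<le> \<delta>\<close> s by simp
    then show ?thesis
      using zero_le_power2[of "norm ?w - ?e"] unfolding power2_sum by linarith
  qed
  finally have "norm (V s) \<le> norm y + ?e"
    by (rule power2_le_imp_le) (use \<open>0 \<le> \<delta>\<close> s in simp)
  then show ?thesis using s by (simp add: field_simps)
qed

text \<open>Subtract the two equations and pair with the difference of the solutions; monotonicity
  discards \<open>F\<close>. The bound involves the norm of \<open>V\<close> at the base parameter
  \<open>s\<close> only, so it controls the motion of \<open>V\<close> to first order without
  differentiating \<open>V\<close>.\<close>

lemma regularized_lipschitz:
  fixes F :: "'a::real_inner \<Rightarrow> 'a"
  assumes mono: "monotone_operator F" and V: "regularized_solutions F f\<^sub>\<delta> V"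
    and s: "0 < s" and s': "0 < s'"
  shows "norm (V s' - V s) \<le> \<bar>s' - s\<bar> / s' * norm (V s)"
proof (cases "V s' = V s")
  case False
  let ?d = "V s' - V s"
  have "F (V s') - F (V s) = (s - s') *\<^sub>R V s - s' *\<^sub>R ?d"
    using regularized_eq[OF V s] regularized_eq[OF V s'] by (simp add: algebra_simps eq_diff_eq)
  moreover have "0 \<le> inner (F (V s') - F (V s)) ?d"
    using mono by (simp add: monotone_operator_def)
  ultimately have "s' * (norm ?d * norm ?d) \<le> inner ((s - s') *\<^sub>R V s) ?d"
    by (simp add: inner_diff_left flip: power2_norm_eq_inner power2_eq_square)
  also have "\<dots> \<le> norm ((s - s') *\<^sub>R V s) * norm ?d" by (rule norm_cauchy_schwarz)
  finally have "s' * norm ?d \<le> \<bar>s' - s\<bar> * norm (V s)"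
    using False by (simp add: mult.assoc[symmetric] abs_minus_commute)
  then show ?thesis using s' by (simp add: field_simps)
qed (use s' in simp)

lemma continuous_on_regularized:
  fixes F :: "'a::real_inner \<Rightarrow> 'a"
  assumes mono: "monotone_operator F" and V: "regularized_solutions F f\<^sub>\<delta> V"
  shows "continuous_on {0<..} V"
  unfolding continuous_on_def
proof
  fix s :: real assume "s \<in> {0<..}"
  then have s: "s > 0" by simp
  have "((\<lambda>s'. \<bar>s' - s\<bar> / s' * norm (V s)) \<longlongrightarrow> \<bar>s - s\<bar> / s * norm (V s)) (at s within {0<..})"
    using s by (intro tendsto_intros) auto
  then have "((\<lambda>s'. \<bar>s' - s\<bar> / s' * norm (V s)) \<longlongrightarrow> 0) (at s within {0<..})" by simp
  then have "((\<lambda>s'. V s' - V s) \<longlongrightarrow> 0) (at s within {0<..})"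
    by (rule Lim_null_comparison[rotated])
      (use regularized_lipschitz[OF mono V s] in \<open>auto simp: eventually_at_filter\<close>)
  then show "(V \<longlongrightarrow> V s) (at s within {0<..})" by (simp add: LIM_zero_iff)
qed



text \<open>The condition \<open>M 1 / norm y \<le> lam\<close> makes the Lipschitz part of the
  residual at most s |y|, and the regularized equation bounds the rest by s |y| + delta. Comparing 2
  s |y| + delta with (2 C - 1) delta and halving explains the choice of C as the mean of C1 and
  1.\<close>

lemma noise_lt_regularization:
  fixes F :: "'a::real_inner \<Rightarrow> 'a"
  assumes mono: "monotone_operator F" and V: "regularized_solutions F f\<^sub>\<delta> V"
    and tf: "twice_frechet F F' F''" and fb: "frechet_bounds F F' F'' u0 r M"
    and \<delta>: "norm (f\<^sub>\<delta> - F y) \<le> \<delta>" and y: "y \<noteq> 0"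
    and lam: "0 < lam" "M 1 / norm y \<le> lam" and s: "0 < s"
    and x: "x \<in> cball u0 r" and Vs: "V s \<in> cball u0 r" and near: "norm (x - V s) \<le> s / lam"
    and level: "(2 * C - 1) * \<delta> < norm (F x - f\<^sub>\<delta>)"
  shows "\<delta> * (C - 1) < s * norm y"
proof -
  have "norm (F x - F (V s)) \<le> M 1 * norm (x - V s)"
    by (rule frechet_lipschitz[OF tf fb x Vs])
  also have "\<dots> \<le> (lam * norm y) * (s / lam)"
    using lam y near by (intro mult_mono) (auto simp: field_simps)
  finally have 1: "norm (F x - F (V s)) \<le> s * norm y" using lam by (simp add: field_simps)
  have "F (V s) - f\<^sub>\<delta> = - (s *\<^sub>R V s)"
    using regularized_eq[OF V s] by (simp add: eq_neg_iff_add_eq_0 algebra_simps)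
  then have 2: "norm (F (V s) - f\<^sub>\<delta>) \<le> s * norm y + \<delta>"
    using regularized_norm_bound[OF mono V s \<delta>] s by simp
  have "norm (F x - f\<^sub>\<delta>) \<le> norm (F x - F (V s)) + norm (F (V s) - f\<^sub>\<delta>)"
    using norm_triangle_ineq[of "F x - F (V s)" "F (V s) - f\<^sub>\<delta>"] by simp
  with 1 2 level have "(2 * C - 1) * \<delta> < 2 * (s * norm y) + \<delta>" by linarith
  then show ?thesis by (simp add: algebra_simps)
qed

text \<open>Insert delta \<le> s |y| / (C - 1) into |V s| \<le> |y| + delta / s and use 1 + 1 / (C -
  1) = C / (C - 1). The weak form places points in the ball; the strict form provides the strict
  slope inequality at contact.\<close>

lemma regularized_norm_le:
  fixes F :: "'a::real_inner \<Rightarrow> 'a"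
  assumes mono: "monotone_operator F" and V: "regularized_solutions F f\<^sub>\<delta> V"
    and \<delta>: "norm (f\<^sub>\<delta> - F y) \<le> \<delta>" and C: "1 < C" and s: "0 < s"
  shows "\<delta> * (C - 1) \<le> s * norm y \<Longrightarrow> norm (V s) \<le> C * norm y / (C - 1)"
    and "\<delta> * (C - 1) < s * norm y \<Longrightarrow> norm (V s) < C * norm y / (C - 1)"
proof -
  have "(C - 1) * (s * norm (V s)) \<le> (C - 1) * (s * norm y + \<delta>)"
    using regularized_norm_bound[OF mono V s \<delta>] C by (intro mult_left_mono) auto
  then have *: "s * (norm (V s) * (C - 1)) \<le> s * (C * norm y) - s * norm y + \<delta> * (C - 1)"
    by (simp add: algebra_simps)
  show "norm (V s) \<le> C * norm y / (C - 1)" if "\<delta> * (C - 1) \<le> s * norm y"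
  proof -
    have "s * (norm (V s) * (C - 1)) \<le> s * (C * norm y)" using * that by linarith
    then show ?thesis using s C by (simp add: pos_le_divide_eq)
  qed
  show "norm (V s) < C * norm y / (C - 1)" if "\<delta> * (C - 1) < s * norm y"
  proof -
    have "s * (norm (V s) * (C - 1)) < s * (C * norm y)" using * that by linarith
    then show ?thesis using s C by (simp add: pos_less_divide_eq)
  qed
qed

section \<open>Comparison to the right of a contact point\<close>

text \<open>The linearization error is o(s - t), while \<open>q\<close> grows at least like (q'/2)(s
  - t); both are compared with this same linear function. It stands in for a Dini derivative of the
  distance.\<close>

lemma linearization_error_le_right:
  fixes u :: "real \<Rightarrow> 'a::real_normed_vector"
  assumes u: "(u has_vector_derivative u') (at t within S)"
    and q: "(q has_real_derivative q') (at t)" "q t = 0" "0 < q'"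
  shows "\<exists>e>0. \<forall>s\<in>S. t < s \<and> s < t + e \<longrightarrow> norm (u s - u t - (s - t) *\<^sub>R u') \<le> q s"
proof -
  have "q' / 2 > 0" using q by simp
  with u obtain e1 where e1: "e1 > 0"
    "\<And>s. s \<in> S \<Longrightarrow> \<bar>s - t\<bar> < e1 \<Longrightarrow> norm (u s - u t - (s - t) *\<^sub>R u') \<le> q' / 2 * \<bar>s - t\<bar>"
    unfolding has_vector_derivative_def has_derivative_within_alt real_norm_def by blast
  from q(1) \<open>q' / 2 > 0\<close> obtain e2 where e2: "e2 > 0"
    "\<And>s. \<bar>s - t\<bar> < e2 \<Longrightarrow> \<bar>q s - q t - q' * (s - t)\<bar> \<le> q' / 2 * \<bar>s - t\<bar>"
    unfolding has_field_derivative_def has_derivative_at_alt real_norm_def by blast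
  show ?thesis
  proof (intro exI[of _ "min e1 e2"] conjI ballI impI)
    fix s assume s: "s \<in> S" "t < s \<and> s < t + min e1 e2"
    have "\<bar>q s - q' * (s - t)\<bar> \<le> q' / 2 * (s - t)"
      using e2(2)[of s] s q(2) by (simp add: min_def split: if_splits)
    then have "q' * (s - t) - q s \<le> q' / 2 * (s - t)" by linarith
    then have "q' / 2 * (s - t) \<le> q s" by (simp add: field_simps)
    then show "norm (u s - u t - (s - t) *\<^sub>R u') \<le> q s"
      using e1(2)[of s] s by (simp add: min_def split: if_splits)
  qed (use e1 e2 in auto)
qed

text \<open>The norm itself is never differentiated. The difference at time s is split into the
  linearization error of \<open>u\<close>, the contracted difference (1 - (s - t)) w, the defect of
  the Newton step and the motion of \<open>V\<close>. The hypothesis \<open>slope\<close> says that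
  the bounds on the last three grow more slowly than a / lam, leaving room for the first.\<close>

lemma newton_distance_le_right:
  fixes F :: "'a::{real_inner,banach} \<Rightarrow> 'a"
  assumes mono: "monotone_operator F" and V: "regularized_solutions F f\<^sub>\<delta> V"
    and tf: "twice_frechet F F' F''" and fb: "frechet_bounds F F' F'' u0 r M"
    and ut: "u t \<in> cball u0 r" and Vt: "V (a t) \<in> cball u0 r"
    and tS: "t \<in> S"
    and u: "(u has_vector_derivative
          - inv (\<lambda>h. F' (u t) h + a t *\<^sub>R h) (F (u t) + a t *\<^sub>R u t - f\<^sub>\<delta>)) (at t within S)"
    and a: "(a has_real_derivative a') (at t)" "\<And>s. t \<le> s \<Longrightarrow> 0 < a s"
      "\<And>s. t \<le> s \<Longrightarrow> a s \<le> a t"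
    and lam: "0 < lam" and g: "norm (u t - V (a t)) = a t / lam"
    and slope: "M 2 / 2 / a t * (a t / lam)\<^sup>2 - a' / a t * norm (V (a t)) < a t / lam + a' / lam"
  shows "\<exists>e>0. \<forall>s\<in>S. t < s \<and> s < t + e \<longrightarrow> norm (u s - V (a s)) \<le> a s / lam"
proof -
  define w where "w = u t - V (a t)"
  define A where "A = (\<lambda>h. F' (u t) h + a t *\<^sub>R h)"
  define z where "z = inv A (F (u t) + a t *\<^sub>R u t - f\<^sub>\<delta>)"
  define \<gamma> where "\<gamma> = M 2 / 2 / a t * (norm w)\<^sup>2"
  define \<nu> where "\<nu> = norm (V (a t))"
  have at: "0 < a t" using a(2) by simp
  have nonneg: "0 \<le> inner (F' (u t) h) h" for h
    using monotone_derivative_nonneg[OF mono] tf unfolding twice_frechet_def by blast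
  have Az: "A z = F (u t) + a t *\<^sub>R u t - f\<^sub>\<delta>"
    unfolding z_def A_def
    by (rule surj_f_inv_f[OF coercive_surj[OF blinfun.bounded_linear_right nonneg at]])
  \<comment> \<open>Since \<open>V (a t)\<close> solves the regularized equation, A(z - w) is the
    Taylor remainder: the Newton direction \<open>z\<close> equals \<open>w\<close> up to a
    quadratic error.\<close>
  have "A (z - w) = A z - A w" by (simp add: A_def blinfun.diff_right algebra_simps)
  also have "\<dots> = F (u t) - F (V (a t)) - F' (u t) w"
    unfolding Az using regularized_eq[OF V at]
    by (simp add: A_def w_def algebra_simps eq_diff_eq)
  finally have "norm (z - w) \<le> norm (F (u t) - F (V (a t)) - F' (u t) w) / a t"
    using coercive_norm_bound[of "blinfun_apply (F' (u t))" "z - w" "a t", OF nonneg at] by (simp add: A_def)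
  also have "\<dots> \<le> M 2 / 2 * (norm w)\<^sup>2 / a t"
    unfolding w_def using at by (intro divide_right_mono frechet_taylor[OF tf fb ut Vt]) auto
  finally have zw: "norm (z - w) \<le> \<gamma>" by (simp add: \<gamma>_def)
  \<comment> \<open>\<open>q s\<close> is the room left under a(s) / lam once the three explicit
    bounds are subtracted; its derivative at t is positive exactly by \<open>slope\<close>.\<close>
  define q where "q = (\<lambda>s. a s / lam - ((1 - (s - t)) * (a t / lam) + (s - t) * \<gamma> + (a t - a s) / a s * \<nu>))"
  have q0: "q t = 0" using at by (simp add: q_def)
  have dq: "(q has_real_derivative (a' / lam + a t / lam - \<gamma> + a' / a t * \<nu>)) (at t)"
    unfolding q_def using at lam
    by (auto intro!: derivative_eq_intros a(1) simp: field_simps)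
  have "0 < a' / lam + a t / lam - \<gamma> + a' / a t * \<nu>"
    using slope g by (simp add: \<gamma>_def \<nu>_def w_def)
  from linearization_error_le_right[OF u dq q0 this] obtain e where e: "e > 0"
    "\<And>s. s \<in> S \<Longrightarrow> t < s \<Longrightarrow> s < t + e \<Longrightarrow> norm (u s - u t - (s - t) *\<^sub>R (- z)) \<le> q s"
    unfolding z_def A_def by blast
  show ?thesis
  proof (intro exI[of _ "min e 1"] conjI ballI impI)
    fix s assume sS: "s \<in> S" and s: "t < s \<and> s < t + min e 1"
    have as: "0 < a s" "a s \<le> a t" using a s by auto
    have "u s - V (a s) = (u s - u t - (s - t) *\<^sub>R (- z)) + (1 - (s - t)) *\<^sub>R w
        - (s - t) *\<^sub>R (z - w) - (V (a s) - V (a t))"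
      by (simp add: w_def algebra_simps)
    also have "norm \<dots> \<le> norm (u s - u t - (s - t) *\<^sub>R (- z)) + norm ((1 - (s - t)) *\<^sub>R w)
        + norm ((s - t) *\<^sub>R (z - w)) + norm (V (a s) - V (a t))"
      by (smt (verit) norm_triangle_ineq norm_triangle_ineq4)
    also have "\<dots> \<le> q s + (1 - (s - t)) * (a t / lam) + (s - t) * \<gamma> + (a t - a s) / a s * \<nu>"
    proof (intro add_mono)
      show "norm (u s - u t - (s - t) *\<^sub>R (- z)) \<le> q s" by (rule e(2)) (use sS s in auto)
      \<comment> \<open>This is why the neighbourhood is cut off at length 1: the absolute value of
        the contraction factor may then be dropped.\<close>
      have "0 \<le> 1 - (s - t)" using s by linarith
      then show "norm ((1 - (s - t)) *\<^sub>R w) \<le> (1 - (s - t)) * (a t / lam)"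
        using g by (simp add: w_def)
      show "norm ((s - t) *\<^sub>R (z - w)) \<le> (s - t) * \<gamma>"
        using s zw by (simp add: mult_left_mono)
      show "norm (V (a s) - V (a t)) \<le> (a t - a s) / a s * \<nu>"
        using regularized_lipschitz[OF mono V at as(1)] as by (simp add: \<nu>_def)
    qed
    also have "\<dots> = a s / lam" by (simp add: q_def)
    finally show "norm (u s - V (a s)) \<le> a s / lam" .
  qed (use e in auto)
qed

lemma continuous_on_neg_right:
  fixes h :: "real \<Rightarrow> real"
  assumes "continuous_on S h" "t \<in> S" "h t < 0"
  shows "\<exists>e>0. \<forall>s\<in>S. t < s \<and> s < t + e \<longrightarrow> h s \<le> 0"
proof -
  have "0 < - h t" using assms by simp
  with assms(1,2) obtain e where e: "e > 0"
    "\<And>s. s \<in> S \<Longrightarrow> dist s t < e \<Longrightarrow> dist (h s) (h t) < - h t"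
    unfolding continuous_on_iff by blast
  show ?thesis
  proof (intro exI[of _ e] conjI ballI impI)
    fix s assume "s \<in> S" "t < s \<and> s < t + e"
    then have "dist (h s) (h t) < - h t" by (intro e(2)) (auto simp: dist_real_def)
    then show "h s \<le> 0" by (simp add: dist_real_def)
  qed (rule e(1))
qed

lemma admissible_start_distance:
  assumes "admissible_start F f\<^sub>\<delta> a V level u0" "0 < a 0" "norm (F 0 - f\<^sub>\<delta>) \<le> (a 0)\<^sup>2 / lam"
  shows "norm (u0 - V (a 0)) \<le> a 0 / lam"
proof -
  have "norm (u0 - V (a 0)) \<le> norm (F 0 - f\<^sub>\<delta>) / a 0"
    using assms(1) by (simp add: admissible_start_def)
  also have "\<dots> \<le> ((a 0)\<^sup>2 / lam) / a 0"
    using assms(2,3) by (intro divide_right_mono) auto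
  finally show ?thesis using assms(2) by (simp add: power2_eq_square)
qed

section \<open>The coupled estimate along the trajectory\<close>

lemma newton_trajectory_estimate:
  fixes F :: "'a::{real_inner,banach} \<Rightarrow> 'a"
  assumes mono: "monotone_operator F" and V: "regularized_solutions F f\<^sub>\<delta> V"
    and tf: "twice_frechet F F' F''"
    and fb: "frechet_bounds F F' F'' u0 (traj_radius (a 0) lam C y u0) M"
    and \<delta>: "norm (f\<^sub>\<delta> - F y) \<le> \<delta>" and y: "y \<noteq> 0" and C: "1 < C"
    and level: "(2 * C - 1) * \<delta> \<le> level"
    and a: "\<And>t. 0 \<le> t \<Longrightarrow> 0 < a t" "\<And>t. 0 \<le> t \<Longrightarrow> (a has_real_derivative a' t) (at t)"
      "\<And>t. 0 \<le> t \<Longrightarrow> a' t < 0"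
    and reg: "reg_conditions a (M 2 / 2) (norm y * (1 + 1 / (C - 1))) lam (norm (F 0 - f\<^sub>\<delta>))"
    and lam: "M 1 / norm y \<le> lam"
    and start: "admissible_start F f\<^sub>\<delta> a V level u0"
    and traj: "newton_trajectory F F' f\<^sub>\<delta> a u0 T u"
    and stop: "stopping_time F f\<^sub>\<delta> u level T"
    and t: "t \<in> {0..T}"
  shows "norm (u t - V (a t)) \<le> a t / lam \<and> norm (V (a t)) \<le> C * norm y / (C - 1)"
proof -
  let ?R = "traj_radius (a 0) lam C y u0"
  have lam0: "0 < lam" using reg by (simp add: reg_conditions_def)
  have decr: "a s \<le> a t" if "0 \<le> t" "t \<le> s" for s t
  proof (rule DERIV_nonpos_imp_nonincreasing[OF that(2)])
    fix x assume "t \<le> x"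
    then have "0 \<le> x" using that by simp
    then show "\<exists>y. (a has_real_derivative y) (at x) \<and> y \<le> 0"
      using a(2,3) less_imp_le by blast
  qed
  have cont_a: "continuous_on {0..T} a"
    by (intro continuous_at_imp_continuous_on ballI DERIV_isCont[OF a(2)]) simp
  have u0: "u 0 = u0" using traj by (simp add: newton_trajectory_def)
  have "continuous_on {0..T} u"
    using traj has_vector_derivative_continuous
    unfolding newton_trajectory_def continuous_on_eq_continuous_within by blast
  moreover have "continuous_on {0..T} (\<lambda>t. V (a t))"
    by (rule continuous_on_compose2[OF continuous_on_regularized[OF mono V] cont_a]) (use a(1) in auto)
  ultimately have cont_g: "continuous_on {0..T} (\<lambda>t. norm (u t - V (a t)) - a t / lam)"
    using lam0 by (intro continuous_intros cont_a) auto
  \<comment> \<open>The bounds on the derivatives of \<open>F\<close> hold only in the ball, and it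
    takes both estimates together to place \<open>u t\<close> and \<open>V (a t)\<close>
    there.\<close>
  have inball: "u t \<in> cball u0 ?R" "V (a t) \<in> cball u0 ?R"
    if "0 \<le> t" "norm (u t - V (a t)) \<le> a t / lam" "\<delta> * (C - 1) \<le> a t * norm y" for t
  proof -
    have v: "norm (V (a t)) \<le> C * norm y / (C - 1)"
      using regularized_norm_le(1)[OF mono V \<delta> C a(1)] that by blast
    have l: "0 < a t / lam" "a t / lam \<le> a 0 / lam"
      using a(1)[of t] decr[of 0 t] that lam0 by (auto intro: divide_right_mono)
    show "V (a t) \<in> cball u0 ?R"
      using v l norm_triangle_ineq4[of u0 "V (a t)"] by (simp add: dist_norm traj_radius_def)
    have "norm (u0 - u t) \<le> norm (u0 - V (a t)) + norm (u t - V (a t))"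
      using norm_triangle_ineq4[of "u0 - V (a t)" "u t - V (a t)"] by simp
    then show "u t \<in> cball u0 ?R"
      using v l that(2) norm_triangle_ineq4[of u0 "V (a t)"]
      by (simp add: dist_norm traj_radius_def)
  qed
  \<comment> \<open>Weak inequalities survive the passage to a limit point; strictness is regained
    separately at each time before \<open>T\<close>.\<close>
  define P where "P = (\<lambda>t. norm (u t - V (a t)) - a t / lam \<le> 0 \<and> \<delta> * (C - 1) - a t * norm y \<le> 0)"
  have "P t"
  proof (rule real_interval_induct[OF _ _ _ t])
    have a0: "0 < a 0" using a(1) by simp
    have g0: "norm (u0 - V (a 0)) \<le> a 0 / lam"
      using admissible_start_distance[OF start a0] reg by (simp add: reg_conditions_def)
    \<comment> \<open>The second estimate is not yet known at time 0, so \<open>inball\<close>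
      cannot be used. Instead \<open>u0\<close> is the centre of the ball and \<open>V (a 0)\<close>
      lies within a(0) / lam of it.\<close>
    have "0 < C * norm y / (C - 1)" "0 < a 0 / lam" using C y lam0 a0 by simp_all
    then have "0 \<le> ?R" "a 0 / lam \<le> ?R"
      using norm_ge_zero[of u0] unfolding traj_radius_def by linarith+
    then have "u0 \<in> cball u0 ?R" "V (a 0) \<in> cball u0 ?R"
      using g0 by (simp_all add: dist_norm)
    moreover have "(2 * C - 1) * \<delta> < norm (F u0 - f\<^sub>\<delta>)"
      using level start by (simp add: admissible_start_def)
    ultimately have "\<delta> * (C - 1) < a 0 * norm y"
      using noise_lt_regularization[OF mono V tf fb \<delta> y lam0 lam a0 _ _ g0] by blast
    then show "P 0" using g0 by (simp add: P_def u0)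
  next
    fix t assume t: "0 < t" "t \<le> T" and IH: "\<And>s. 0 \<le> s \<Longrightarrow> s < t \<Longrightarrow> P s"
    have cl: "closure {0..<t} = {0..t}" and tcl: "t \<in> closure {0..<t}" using t by auto
    have sub: "closure {0..<t} \<subseteq> {0..T}" using t cl by auto
    have "norm (u t - V (a t)) - a t / lam \<le> 0"
      by (rule continuous_le_on_closure[OF continuous_on_subset[OF cont_g sub] tcl])
        (use IH in \<open>simp add: P_def\<close>)
    moreover have "\<delta> * (C - 1) - a t * norm y \<le> 0"
    proof (rule continuous_le_on_closure[OF _ tcl])
      show "continuous_on (closure {0..<t}) (\<lambda>t. \<delta> * (C - 1) - a t * norm y)"
        by (intro continuous_intros continuous_on_subset[OF cont_a sub])
    qed (use IH in \<open>simp add: P_def\<close>)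
    ultimately show "P t" by (simp add: P_def)
  next
    fix t assume t: "0 \<le> t" "t < T" and Pt: "P t"
    have at: "0 < a t" using a(1) t by simp
    have g: "norm (u t - V (a t)) \<le> a t / lam" and d: "\<delta> * (C - 1) \<le> a t * norm y"
      using Pt by (auto simp: P_def)
    note ball = inball[OF t(1) g d]
    have "(2 * C - 1) * \<delta> < norm (F (u t) - f\<^sub>\<delta>)"
    proof -
      have "t \<in> {0..<T}" using t by simp
      then have "level < norm (F (u t) - f\<^sub>\<delta>)" using stop by (simp add: stopping_time_def)
      then show ?thesis using level by simp
    qed
    then have d': "\<delta> * (C - 1) < a t * norm y"
      by (rule noise_lt_regularization[OF mono V tf fb \<delta> y lam0 lam at ball g])
    have v: "norm (V (a t)) < C * norm y / (C - 1)"
      by (rule regularized_norm_le(2)[OF mono V \<delta> C at d'])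
    have tT: "t \<in> {0..T}" using t by simp
    \<comment> \<open>The differential equation matters only at contact, when the distance equals
      a(t) / lam; otherwise continuity is enough.\<close>
    have "\<exists>e>0. \<forall>s\<in>{0..T}. t < s \<and> s < t + e \<longrightarrow> norm (u s - V (a s)) - a s / lam \<le> 0"
    proof (cases "norm (u t - V (a t)) = a t / lam")
      case True
      define \<rho> where "\<rho> = - a' t / a t"
      have \<rho>: "\<rho> > 0" using at a(3)[OF t(1)] by (simp add: \<rho>_def divide_neg_pos)
      have a't: "a' t = - \<rho> * a t" using at by (simp add: \<rho>_def)
      have dv: "\<bar>deriv a t\<bar> / a t = \<rho>"
        using DERIV_imp_deriv[OF a(2)[OF t(1)]] a(3)[OF t(1)] by (simp add: \<rho>_def)
      have r1: "M 2 / 2 / a t \<le> lam / (2 * a t) * (1 - \<rho>)"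
        and r2: "norm y * (1 + 1 / (C - 1)) * \<rho> \<le> a t / (2 * lam) * (1 - \<rho>)"
        using reg t(1) unfolding reg_conditions_def by (auto simp flip: dv)
      \<comment> \<open>At contact each of the two conditions on \<open>a\<close> costs at most half
        of (a / lam)(1 - rho), and this whole equals a / lam + a' / lam.\<close>
      have "M 2 / 2 / a t * (a t / lam)\<^sup>2 \<le> lam / (2 * a t) * (1 - \<rho>) * (a t / lam)\<^sup>2"
        by (intro mult_right_mono r1) simp
      also have "\<dots> = a t / (2 * lam) * (1 - \<rho>)"
        using at lam0 by (simp add: power2_eq_square)
      finally have s1: "M 2 / 2 / a t * (a t / lam)\<^sup>2 \<le> a t / (2 * lam) * (1 - \<rho>)" .
      have "norm y * (1 + 1 / (C - 1)) = C * norm y / (C - 1)"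
        using C by (simp add: field_simps)
      \<comment> \<open>Strictness of \<open>slope\<close> comes from here: the norm of V is
        strictly below c1, and rho is positive because a' < 0.\<close>
      then have "norm (V (a t)) * \<rho> < norm y * (1 + 1 / (C - 1)) * \<rho>"
        using v \<rho> by (metis mult_strict_right_mono)
      with r2 have s2: "\<rho> * norm (V (a t)) < a t / (2 * lam) * (1 - \<rho>)"
        by (simp add: mult.commute)
      have "a t / (2 * lam) * (1 - \<rho>) + a t / (2 * lam) * (1 - \<rho>) = a t / lam + a' t / lam"
        unfolding a't using lam0 by (simp add: field_simps)
      moreover have "a' t / a t * norm (V (a t)) = - (\<rho> * norm (V (a t)))"
        unfolding a't using at by simp
      ultimately have slope: "M 2 / 2 / a t * (a t / lam)\<^sup>2 - a' t / a t * norm (V (a t)) < a t / lam + a' t / lam"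
        using s1 s2 by linarith
      have du: "(u has_vector_derivative
          - inv (\<lambda>h. F' (u t) h + a t *\<^sub>R h) (F (u t) + a t *\<^sub>R u t - f\<^sub>\<delta>)) (at t within {0..T})"
        using traj tT by (simp add: newton_trajectory_def)
      have "0 < a s" "a s \<le> a t" if "t \<le> s" for s
        using that t a(1) decr by auto
      then have "\<exists>e>0. \<forall>s\<in>{0..T}. t < s \<and> s < t + e \<longrightarrow> norm (u s - V (a s)) \<le> a s / lam"
        by (intro newton_distance_le_right[where u = u and t = t and V = V and a = a and S = "{0..T}",
          OF mono V tf fb ball tT du a(2)[OF t(1)] _ _ lam0 True slope])
      then show ?thesis by simp
    next
      case False
      then have "norm (u t - V (a t)) - a t / lam < 0" using g by simp
      then show ?thesis
        using continuous_on_neg_right[OF cont_g tT] by blast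
    qed
    then obtain e1 where e1: "e1 > 0"
      "\<And>s. s \<in> {0..T} \<Longrightarrow> t < s \<Longrightarrow> s < t + e1 \<Longrightarrow> norm (u s - V (a s)) - a s / lam \<le> 0" by blast
    have "continuous_on {0..T} (\<lambda>t. \<delta> * (C - 1) - a t * norm y)"
      by (intro continuous_intros cont_a)
    from continuous_on_neg_right[OF this tT] d' obtain e2 where e2: "e2 > 0"
      "\<And>s. s \<in> {0..T} \<Longrightarrow> t < s \<Longrightarrow> s < t + e2 \<Longrightarrow> \<delta> * (C - 1) - a s * norm y \<le> 0" by auto
    show "\<exists>e>0. \<forall>s. t < s \<and> s < t + e \<and> s \<le> T \<longrightarrow> P s"
      using e1 e2 t by (intro exI[of _ "min e1 e2"]) (auto simp: P_def)
  qed
  then show ?thesis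
    using regularized_norm_le(1)[OF mono V \<delta> C, of "a t"] a(1)[of t] t by (simp add: P_def)
qed

section \<open>The regularization function and the choice of its parameters\<close>

lemma reg_fun_pos: "0 < c \<Longrightarrow> 0 < d \<Longrightarrow> 0 \<le> t \<Longrightarrow> 0 < reg_fun b c d t"
  by (simp add: reg_fun_def)

text \<open>Writing the derivative as a multiple of the function shows the ratio |a'| / a to be b /
  (c + t).\<close>

lemma reg_fun_deriv:
  assumes "0 < c" "0 \<le> t"
  shows "(reg_fun b c d has_real_derivative - b / (c + t) * reg_fun b c d t) (at t)"
proof -
  have "((\<lambda>t. d / (c + t) powr b) has_real_derivative - b / (c + t) * (d / (c + t) powr b)) (at t)"
  proof (rule DERIV_cong)
    show "((\<lambda>t. d / (c + t) powr b) has_real_derivative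
        - (d * (b * (c + t) powr (b - 1))) / ((c + t) powr b * (c + t) powr b)) (at t)"
      using assms by (auto intro!: derivative_eq_intros)
    have "- (d * (b * (p / x))) / (p * p) = - b / x * (d / p)" if "x > 0" "p > 0" for x p :: real
      using that by (simp add: field_simps)
    from this[of "c + t" "(c + t) powr b"]
    show "- (d * (b * (c + t) powr (b - 1))) / ((c + t) powr b * (c + t) powr b)
        = - b / (c + t) * (d / (c + t) powr b)"
      using assms by (simp add: powr_diff)
  qed
  then show ?thesis by (simp add: reg_fun_def[abs_def])
qed

lemma reg_fun_deriv_neg:
  assumes "0 < b" "0 < c" "0 < d" "0 \<le> t"
  shows "- b / (c + t) * reg_fun b c d t < 0"
  using assms reg_fun_pos[of c d t b] by (simp add: mult_neg_pos)

lemma reg_fun_less: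
  assumes "0 < b" "0 < c" "0 < d" "0 < t"
  shows "reg_fun b c d t < reg_fun b c d 0"
  using assms by (auto simp: reg_fun_def intro!: divide_strict_left_mono powr_less_mono2)

text \<open>The order of quantifiers is the point: \<open>B\<close> is fixed from y, C, b and c
  before \<open>F\<close>, the data and the derivative bounds are given.\<close>

lemma admissible_parameters_exist:
  fixes y :: "'a::real_normed_vector"
  assumes y: "y \<noteq> 0" and C: "1 < C" and b: "0 < b" "b \<le> 1" and c: "0 < c" "6 * b < c"
  shows "\<exists>B>0. \<forall>(F :: 'a \<Rightarrow> 'a) f\<^sub>\<delta> M. 0 < M 2 \<longrightarrow>
    (\<exists>d lam. admissible_parameters F f\<^sub>\<delta> y C M b c d lam \<and> reg_fun b c d 0 / lam \<le> B)"
proof -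
  define c1 where "c1 = norm y * (1 + 1 / (C - 1))"
  have c1: "0 < c1" using y C by (simp add: c1_def add_pos_pos)
  \<comment> \<open>The factor 12/5 is the reciprocal of (1/2)(5/6), where 5/6 bounds 1 - b / (c +
    t) from below as 6 b < c. Since b \<le> 1, c^(1 - b) is the least value of (c + t)^(1 - b) for t
    \<ge> 0, so the second condition holds at all times.\<close>
  define \<kappa> where "\<kappa> = 12 / 5 * b * c1 / c powr (1 - b)"
  have \<kappa>: "0 < \<kappa>" using b c c1 by (simp add: \<kappa>_def)
  define B where "B = \<kappa> / c powr b"
  have B: "0 < B" using \<kappa> c by (simp add: B_def)
  have "\<exists>d lam. admissible_parameters F f\<^sub>\<delta> y C M b c d lam \<and> reg_fun b c d 0 / lam \<le> B"
    if M: "0 < M 2" for F :: "'a \<Rightarrow> 'a" and f\<^sub>\<delta> and M :: "nat \<Rightarrow> real"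
  proof -
    \<comment> \<open>The three entries serve, in turn, the bound involving \<open>M 1\<close>, the
      first condition on \<open>a\<close> (again through 5/6), and the condition on the initial
      residual, which reads |F 0 - f_delta| \<le> B^2 lam because a(0) = B lam.\<close>
    define lam where "lam = max (max (M 1 / norm y) (6 / 5 * M 2)) (norm (F 0 - f\<^sub>\<delta>) / B\<^sup>2)"
    define d where "d = \<kappa> * lam"
    let ?a = "reg_fun b c d"
    have lam: "M 1 / norm y \<le> lam" "6 / 5 * M 2 \<le> lam" "norm (F 0 - f\<^sub>\<delta>) / B\<^sup>2 \<le> lam"
      by (simp_all only: lam_def le_max_iff_disj order.refl simp_thms)
    have lam0: "0 < lam" using lam(2) M by linarith
    have d: "0 < d" using \<kappa> lam0 by (simp add: d_def)
    have a0: "?a 0 = B * lam" by (simp add: reg_fun_def d_def B_def)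
    have apos: "0 < ?a t" if "0 \<le> t" for t using reg_fun_pos c d that by blast
    have ratio: "\<bar>deriv ?a t\<bar> / ?a t = b / (c + t)" if "0 \<le> t" for t
      using DERIV_imp_deriv[OF reg_fun_deriv[OF c(1) that, of b d]] apos[OF that] b c that
      by (simp add: abs_mult)
    have small: "b / (c + t) \<le> 1 / 6" if "0 \<le> t" for t using c that by (simp add: field_simps)
    have "M 2 / 2 / ?a t \<le> lam / (2 * ?a t) * (1 - \<bar>deriv ?a t\<bar> / ?a t)" if t: "0 \<le> t" for t
    proof -
      have "M 2 / 2 \<le> lam / 2 * (5 / 6)" using lam(2) by simp
      also have "\<dots> \<le> lam / 2 * (1 - b / (c + t))"
        using small[OF t] lam0 by (intro mult_left_mono) auto
      finally have "M 2 / 2 / ?a t \<le> lam / 2 * (1 - b / (c + t)) / ?a t"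
        using apos[OF t] by (intro divide_right_mono) auto
      then show ?thesis by (simp add: ratio[OF t])
    qed
    moreover have "c1 * (\<bar>deriv ?a t\<bar> / ?a t) \<le> ?a t / (2 * lam) * (1 - \<bar>deriv ?a t\<bar> / ?a t)"
      if t: "0 \<le> t" for t
    proof -
      have ct: "0 < c + t" using c t by simp
      have split: "(c + t) powr (1 - b) = (c + t) / (c + t) powr b"
        using ct by (simp add: powr_diff)
      have "c1 * (b / (c + t)) = 5 / 12 * (\<kappa> * c powr (1 - b)) / (c + t)"
        using c by (simp add: \<kappa>_def)
      also have "\<dots> \<le> 5 / 12 * (\<kappa> * (c + t) powr (1 - b)) / (c + t)"
        using c b t \<kappa> ct
        by (intro divide_right_mono mult_left_mono powr_mono2) auto
      also have "\<dots> = \<kappa> / (c + t) powr b / 2 * (5 / 6)"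
        unfolding split using ct by simp
      also have "\<dots> \<le> \<kappa> / (c + t) powr b / 2 * (1 - b / (c + t))"
        using small[OF t] \<kappa> by (intro mult_left_mono) auto
      also have "\<kappa> / (c + t) powr b / 2 = ?a t / (2 * lam)"
        using lam0 by (simp add: reg_fun_def d_def)
      finally show ?thesis by (simp add: ratio[OF t])
    qed
    moreover have "norm (F 0 - f\<^sub>\<delta>) \<le> (?a 0)\<^sup>2 / lam"
      using lam(3) B lam0 unfolding a0 by (simp add: field_simps power2_eq_square)
    ultimately have "admissible_parameters F f\<^sub>\<delta> y C M b c d lam"
      using lam(1) lam0 d M c1 by (simp add: admissible_parameters_def reg_conditions_def c1_def)
    moreover have "?a 0 / lam \<le> B" using lam0 by (simp add: a0)
    ultimately show ?thesis by blast
  qed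
  with B show ?thesis by blast
qed

section \<open>Confinement to the ball and the uniform radius\<close>

theorem mainTheorem2:
  fixes y :: "'a::{real_inner,banach}" and C1 C \<zeta> b c :: real
  assumes "y \<noteq> 0"
    and "1 < C1" and "C = (C1 + 1) / 2"
    and "0 < \<zeta>" and "\<zeta> \<le> 1"
    and "0 < b" and "b \<le> 1" and "0 < c" and "6 * b < c"
  shows
    "(\<forall>F F' F'' f \<delta> f\<^sub>\<delta> d lam M V u0 u t\<^sub>\<delta>.
        monotone_problem F F' F'' f y \<and>
        noisy_data f \<delta> f\<^sub>\<delta> \<and>
        frechet_bounds F F' F'' u0 (traj_radius (reg_fun b c d 0) lam C y u0) M \<and>
        admissible_parameters F f\<^sub>\<delta> y C M b c d lam \<and>
        regularized_solutions F f\<^sub>\<delta> V \<and>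
        admissible_start F f\<^sub>\<delta> (reg_fun b c d) V (C1 * \<delta> powr \<zeta>) u0 \<and>
        newton_trajectory F F' f\<^sub>\<delta> (reg_fun b c d) u0 t\<^sub>\<delta> u \<and>
        stopping_time F f\<^sub>\<delta> u (C1 * \<delta> powr \<zeta>) t\<^sub>\<delta> \<longrightarrow>
        (\<forall>t\<in>{0..t\<^sub>\<delta>}.
           u t \<in> ball u0 (traj_radius (reg_fun b c d 0) lam C y u0) \<and>
           norm (u t - u0)
             \<le> norm (u t - V (reg_fun b c d t)) + norm (V (reg_fun b c d t)) + norm u0 \<and>
           norm (u t - V (reg_fun b c d t)) + norm (V (reg_fun b c d t)) + norm u0
             \<le> traj_radius (reg_fun b c d 0) lam C y u0))
     \<and>
     (\<exists>B R. \<forall>F F' F'' f \<delta> f\<^sub>\<delta> M.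
        monotone_problem F F' F'' f y \<and> noisy_data f \<delta> f\<^sub>\<delta> \<and> 0 < M 1 \<and> 0 < M 2 \<longrightarrow>
        (\<exists>d lam.
           admissible_parameters F f\<^sub>\<delta> y C M b c d lam \<and>
           reg_fun b c d 0 / lam \<le> B \<and>
           (\<forall>V u0.
              regularized_solutions F f\<^sub>\<delta> V \<and>
              admissible_start F f\<^sub>\<delta> (reg_fun b c d) V (C1 * \<delta> powr \<zeta>) u0 \<and>
              frechet_bounds F F' F'' u0 R M \<longrightarrow>
              traj_radius (reg_fun b c d 0) lam C y u0 \<le> R \<and>
              (\<forall>u t\<^sub>\<delta>.
                 newton_trajectory F F' f\<^sub>\<delta> (reg_fun b c d) u0 t\<^sub>\<delta> u \<and>
                 stopping_time F f\<^sub>\<delta> u (C1 * \<delta> powr \<zeta>) t\<^sub>\<delta> \<longrightarrow>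
                 (\<forall>t\<in>{0..t\<^sub>\<delta>}. u t \<in> ball u0 R)))))"
proof (rule conjI)
  have C1: "C1 = 2 * C - 1" and C: "1 < C" using assms by auto
  \<comment> \<open>As delta < 1 and zeta \<le> 1, delta^zeta is at least delta, so before the
    stopping time the residual also exceeds C1 delta = (2 C - 1) delta.\<close>
  have level: "(2 * C - 1) * \<delta> \<le> C1 * \<delta> powr \<zeta>" if "noisy_data f \<delta> f\<^sub>\<delta>" for f f\<^sub>\<delta> :: 'a and \<delta>
  proof -
    have "\<delta> powr 1 \<le> \<delta> powr \<zeta>"
      using that assms by (intro powr_mono') (auto simp: noisy_data_def)
    then show ?thesis using that C unfolding C1 by (simp add: noisy_data_def)
  qed
  have part1: "u t \<in> ball u0 (traj_radius (reg_fun b c d 0) lam C y u0) \<and>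
           norm (u t - u0)
             \<le> norm (u t - V (reg_fun b c d t)) + norm (V (reg_fun b c d t)) + norm u0 \<and>
           norm (u t - V (reg_fun b c d t)) + norm (V (reg_fun b c d t)) + norm u0
             \<le> traj_radius (reg_fun b c d 0) lam C y u0"
    if pr: "monotone_problem F F' F'' f y" and nd: "noisy_data f \<delta> f\<^sub>\<delta>"
      and fb: "frechet_bounds F F' F'' u0 (traj_radius (reg_fun b c d 0) lam C y u0) M"
      and ap: "admissible_parameters F f\<^sub>\<delta> y C M b c d lam"
      and V: "regularized_solutions F f\<^sub>\<delta> V"
      and start: "admissible_start F f\<^sub>\<delta> (reg_fun b c d) V (C1 * \<delta> powr \<zeta>) u0"
      and traj: "newton_trajectory F F' f\<^sub>\<delta> (reg_fun b c d) u0 T u"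
      and stop: "stopping_time F f\<^sub>\<delta> u (C1 * \<delta> powr \<zeta>) T" and t: "t \<in> {0..T}"
    for F F' F'' f \<delta> f\<^sub>\<delta> d lam M V u0 u T t
  proof -
    let ?a = "reg_fun b c d"
    have mono: "monotone_operator F" and tf: "twice_frechet F F' F''"
      and \<delta>: "norm (f\<^sub>\<delta> - F y) \<le> \<delta>"
      using pr nd by (auto simp: monotone_problem_def minimal_norm_solution_def noisy_data_def)
    have d: "0 < d" and lam: "M 1 / norm y \<le> lam"
      and reg: "reg_conditions ?a (M 2 / 2) (norm y * (1 + 1 / (C - 1))) lam (norm (F 0 - f\<^sub>\<delta>))"
      using ap by (auto simp: admissible_parameters_def)
    have lam0: "0 < lam" using reg by (simp add: reg_conditions_def)
    have est: "norm (u t - V (?a t)) \<le> ?a t / lam" "norm (V (?a t)) \<le> C * norm y / (C - 1)"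
      using newton_trajectory_estimate[OF mono V tf fb \<delta> assms(1) C level[OF nd]
          reg_fun_pos[OF assms(8) d] reg_fun_deriv[OF assms(8)] reg_fun_deriv_neg[OF assms(6,8) d]
          reg lam start traj stop t]
      by auto
    have "norm (u t - u0) \<le> norm (u t - V (?a t)) + norm (V (?a t)) + norm u0"
      using norm_triangle_ineq[of "u t - V (?a t)" "V (?a t)"] norm_triangle_ineq4[of "u t" u0] by simp
    \<comment> \<open>The ball is open. At t = 0 the trajectory sits at its centre; for t > 0
      strictness comes from a(t) < a(0).\<close>
    moreover have "u t \<in> ball u0 (traj_radius (?a 0) lam C y u0)"
    proof (cases "t = 0")
      case True
      have "0 < C * norm y / (C - 1)" "0 < ?a 0 / lam"
        using C assms(1) lam0 reg_fun_pos[OF assms(8) d] by simp_all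
      then have "0 < traj_radius (?a 0) lam C y u0"
        using norm_ge_zero[of u0] unfolding traj_radius_def by linarith
      then show ?thesis using True traj by (simp add: newton_trajectory_def)
    next
      case False
      then have "?a t / lam < ?a 0 / lam"
        using t reg_fun_less[OF assms(6,8) d] lam0 by (simp add: divide_strict_right_mono)
      then show ?thesis
        using calculation est by (simp add: dist_norm norm_minus_commute traj_radius_def)
    qed
    moreover have "?a t / lam \<le> ?a 0 / lam"
      using t reg_fun_less[OF assms(6,8) d, of t] lam0 by (cases "t = 0") (auto intro!: divide_right_mono)
    ultimately show ?thesis using est by (simp add: traj_radius_def)
  qed
  then show "\<forall>F F' F'' f \<delta> f\<^sub>\<delta> d lam M V u0 u t\<^sub>\<delta>.
        monotone_problem F F' F'' f y \<and>
        noisy_data f \<delta> f\<^sub>\<delta> \<and>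
        frechet_bounds F F' F'' u0 (traj_radius (reg_fun b c d 0) lam C y u0) M \<and>
        admissible_parameters F f\<^sub>\<delta> y C M b c d lam \<and>
        regularized_solutions F f\<^sub>\<delta> V \<and>
        admissible_start F f\<^sub>\<delta> (reg_fun b c d) V (C1 * \<delta> powr \<zeta>) u0 \<and>
        newton_trajectory F F' f\<^sub>\<delta> (reg_fun b c d) u0 t\<^sub>\<delta> u \<and>
        stopping_time F f\<^sub>\<delta> u (C1 * \<delta> powr \<zeta>) t\<^sub>\<delta> \<longrightarrow>
        (\<forall>t\<in>{0..t\<^sub>\<delta>}.
           u t \<in> ball u0 (traj_radius (reg_fun b c d 0) lam C y u0) \<and>
           norm (u t - u0)
             \<le> norm (u t - V (reg_fun b c d t)) + norm (V (reg_fun b c d t)) + norm u0 \<and>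
           norm (u t - V (reg_fun b c d t)) + norm (V (reg_fun b c d t)) + norm u0
             \<le> traj_radius (reg_fun b c d 0) lam C y u0)"
    by blast
  obtain B where B: "B > 0" and params: "\<And>F f\<^sub>\<delta> M. 0 < M 2 \<Longrightarrow>
      \<exists>d lam. admissible_parameters F f\<^sub>\<delta> y C M b c d lam \<and> reg_fun b c d 0 / lam \<le> B"
    using admissible_parameters_exist[OF assms(1) C assms(6-9)] by blast
  \<comment> \<open>The start \<open>u0\<close> varies too, but |u0| \<le> a(0) / lam + |V(a(0))|
    \<le> B + C |y| / (C - 1). Adding this to the other two terms of the radius doubles both
    constants.\<close>
  define R where "R = 2 * B + 2 * (C * norm y / (C - 1))"
  have Cy: "0 < C * norm y / (C - 1)" using C assms(1) by simp
  have radius: "traj_radius (reg_fun b c d 0) lam C y u0 \<le> R"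
    if pr: "monotone_problem F F' F'' f y" and nd: "noisy_data f \<delta> f\<^sub>\<delta>"
      and ap: "admissible_parameters F f\<^sub>\<delta> y C M b c d lam" and aB: "reg_fun b c d 0 / lam \<le> B"
      and V: "regularized_solutions F f\<^sub>\<delta> V"
      and start: "admissible_start F f\<^sub>\<delta> (reg_fun b c d) V (C1 * \<delta> powr \<zeta>) u0"
      and fb: "frechet_bounds F F' F'' u0 R M"
    for F F' F'' f \<delta> f\<^sub>\<delta> d lam M V u0
  proof -
    let ?a = "reg_fun b c d 0"
    have mono: "monotone_operator F" and tf: "twice_frechet F F' F''"
      and \<delta>: "norm (f\<^sub>\<delta> - F y) \<le> \<delta>"
      using pr nd by (auto simp: monotone_problem_def minimal_norm_solution_def noisy_data_def)
    have d: "0 < d" and lam: "M 1 / norm y \<le> lam" and lam0: "0 < lam"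
      and e: "norm (F 0 - f\<^sub>\<delta>) \<le> ?a\<^sup>2 / lam"
      using ap by (auto simp: admissible_parameters_def reg_conditions_def)
    have a0: "0 < ?a" using reg_fun_pos[OF assms(8) d] by simp
    have g0: "norm (u0 - V ?a) \<le> ?a / lam"
      by (rule admissible_start_distance[OF start a0 e])
    \<comment> \<open>Because R \<ge> B \<ge> a(0) / lam, the noise estimate applies at time 0 in
      the ball of radius \<open>R\<close>, before the trajectory radius is known to be at most
      \<open>R\<close>.\<close>
    have "u0 \<in> cball u0 R" "V ?a \<in> cball u0 R"
      using g0 aB B Cy by (auto simp: dist_norm R_def)
    moreover have "(2 * C - 1) * \<delta> < norm (F u0 - f\<^sub>\<delta>)"
      using level[OF nd] start by (simp add: admissible_start_def)
    ultimately have "\<delta> * (C - 1) < ?a * norm y"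
      using noise_lt_regularization[OF mono V tf fb \<delta> assms(1) lam0 lam a0 _ _ g0] by blast
    then have "norm (V ?a) \<le> C * norm y / (C - 1)"
      using regularized_norm_le(2)[OF mono V \<delta> C a0] by simp
    moreover have "norm u0 \<le> norm (u0 - V ?a) + norm (V ?a)"
      using norm_triangle_ineq[of "u0 - V ?a" "V ?a"] by simp
    ultimately show ?thesis using g0 aB unfolding traj_radius_def R_def by linarith
  qed
  show "\<exists>B R. \<forall>F F' F'' f \<delta> f\<^sub>\<delta> M.
        monotone_problem F F' F'' f y \<and> noisy_data f \<delta> f\<^sub>\<delta> \<and> 0 < M 1 \<and> 0 < M 2 \<longrightarrow>
        (\<exists>d lam.
           admissible_parameters F f\<^sub>\<delta> y C M b c d lam \<and>
           reg_fun b c d 0 / lam \<le> B \<and>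
           (\<forall>V u0.
              regularized_solutions F f\<^sub>\<delta> V \<and>
              admissible_start F f\<^sub>\<delta> (reg_fun b c d) V (C1 * \<delta> powr \<zeta>) u0 \<and>
              frechet_bounds F F' F'' u0 R M \<longrightarrow>
              traj_radius (reg_fun b c d 0) lam C y u0 \<le> R \<and>
              (\<forall>u t\<^sub>\<delta>.
                 newton_trajectory F F' f\<^sub>\<delta> (reg_fun b c d) u0 t\<^sub>\<delta> u \<and>
                 stopping_time F f\<^sub>\<delta> u (C1 * \<delta> powr \<zeta>) t\<^sub>\<delta> \<longrightarrow>
                 (\<forall>t\<in>{0..t\<^sub>\<delta>}. u t \<in> ball u0 R))))"
  proof (rule exI[of _ B], rule exI[of _ R], intro allI impI, elim conjE)
    fix F :: "'a \<Rightarrow> 'a" and F' F'' f \<delta> f\<^sub>\<delta> and M :: "nat \<Rightarrow> real"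
    assume pr: "monotone_problem F F' F'' f y" and nd: "noisy_data f \<delta> f\<^sub>\<delta>" and "0 < M 2"
    from params[of M, OF \<open>0 < M 2\<close>] obtain d lam where ap: "admissible_parameters F f\<^sub>\<delta> y C M b c d lam"
      and aB: "reg_fun b c d 0 / lam \<le> B" by blast
    let ?r = "\<lambda>u0. traj_radius (reg_fun b c d 0) lam C y u0"
    have "?r u0 \<le> R \<and>
        (\<forall>u t\<^sub>\<delta>. newton_trajectory F F' f\<^sub>\<delta> (reg_fun b c d) u0 t\<^sub>\<delta> u \<and>
                 stopping_time F f\<^sub>\<delta> u (C1 * \<delta> powr \<zeta>) t\<^sub>\<delta> \<longrightarrow>
                 (\<forall>t\<in>{0..t\<^sub>\<delta>}. u t \<in> ball u0 R))"
      if V: "regularized_solutions F f\<^sub>\<delta> V"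
        and start: "admissible_start F f\<^sub>\<delta> (reg_fun b c d) V (C1 * \<delta> powr \<zeta>) u0"
        and fb: "frechet_bounds F F' F'' u0 R M" for V u0
    proof -
      have r: "?r u0 \<le> R" by (rule radius[OF pr nd ap aB V start fb])
      \<comment> \<open>The derivative bounds restrict to the smaller ball, so the first part
        confines the trajectory there and hence to the ball of radius \<open>R\<close>.\<close>
      then have "frechet_bounds F F' F'' u0 (?r u0) M"
        using fb by (auto simp: frechet_bounds_def)
      from part1[OF pr nd this ap V start] r show ?thesis
        by (meson subset_ball subset_iff)
    qed
    with ap aB show "\<exists>d lam.
           admissible_parameters F f\<^sub>\<delta> y C M b c d lam \<and>
           reg_fun b c d 0 / lam \<le> B \<and>
           (\<forall>V u0.
              regularized_solutions F f\<^sub>\<delta> V \<and>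
              admissible_start F f\<^sub>\<delta> (reg_fun b c d) V (C1 * \<delta> powr \<zeta>) u0 \<and>
              frechet_bounds F F' F'' u0 R M \<longrightarrow>
              traj_radius (reg_fun b c d 0) lam C y u0 \<le> R \<and>
              (\<forall>u t\<^sub>\<delta>.
                 newton_trajectory F F' f\<^sub>\<delta> (reg_fun b c d) u0 t\<^sub>\<delta> u \<and>
                 stopping_time F f\<^sub>\<delta> u (C1 * \<delta> powr \<zeta>) t\<^sub>\<delta> \<longrightarrow>
                 (\<forall>t\<in>{0..t\<^sub>\<delta>}. u t \<in> ball u0 R)))"
      by blast
  qed
qed

end
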